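(* Let $\mathbb{X}$ be a finite set with a partial order $\prec$ that has a smallest element $\mathbf{0}$ and a largest element $\mathbf{1}$. Let $K=(k(x,y))_{x,y\in\mathbb{X}}$ be the transition kernel of an irreducible discrete-time Markov chain on $\mathbb{X}$, and suppose that $K$ is monotone for $\prec$. Then $\mathbf{1}$ is a halting state for the Markov chain with kernel $K$ started at $\mathbf{0}$.
   Context: $K$ is monotone for $\prec$ if for all $x\prec y$ the probability $K(x,\cdot)$ is stochastically smaller than $K(y,\cdot)$, i.e. for every increasing function $f:\mathbb{X}\to\mathbb{R}$ the function $Kf$ is increasing. Let $\pi$ be the stationary distribution and $\pi_n$ the law of the chain at time $n$. A state $x^*$ is a halting state (for total variation) if $\pi_n(x^* )\le\pi(x^* )$ for all $n\ge 0$. *)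

theory Defs
  imports "HOL-Probability.Probability"
begin

text \<open>A transition kernel \<open>k(x, y)\<close> is a map \<open>K :: 'a \<Rightarrow> 'a pmf\<close>, with \<open>k(x, y) = pmf (K x) y\<close>.\<close>

definition kernel_power :: "('a \<Rightarrow> 'a pmf) \<Rightarrow> nat \<Rightarrow> 'a \<Rightarrow> 'a pmf" where
  "kernel_power K n x = ((\<lambda>\<mu>. bind_pmf \<mu> K) ^^ n) (return_pmf x)"

definition irreducible_kernel :: "('a \<Rightarrow> 'a pmf) \<Rightarrow> bool" where
  "irreducible_kernel K \<longleftrightarrow> (\<forall>x y. \<exists>n. pmf (kernel_power K n x) y > 0)"

definition stationary :: "('a \<Rightarrow> 'a pmf) \<Rightarrow> 'a pmf \<Rightarrow> bool" where
  "stationary K \<pi> \<longleftrightarrow> bind_pmf \<pi> K = \<pi>"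

text \<open>``Increasing'' is meant in the weak sense; the expectation is
  \<open>(K f)(x) = \<Sum>y. k(x, y) f(y)\<close>. The definition is intended for finite state spaces, where every
  real-valued \<open>f\<close> is integrable.\<close>

definition monotone_kernel :: "('a::order \<Rightarrow> 'a pmf) \<Rightarrow> bool" where
  "monotone_kernel K \<longleftrightarrow>
     (\<forall>f :: 'a \<Rightarrow> real. mono f \<longrightarrow> mono (\<lambda>x. measure_pmf.expectation (K x) f))"

definition markov_chain :: "'w measure \<Rightarrow> (nat \<Rightarrow> 'w \<Rightarrow> 'a) \<Rightarrow> ('a \<Rightarrow> 'a pmf) \<Rightarrow> bool" where
  "markov_chain M X K \<longleftrightarrow>
     prob_space M \<and>
     (\<forall>n. X n \<in> measurable M (count_space UNIV)) \<and>
     (\<forall>n s y. \<P>(\<omega> in M. \<forall>i\<le>n. X i \<omega> = s i) > 0 \<longrightarrow>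
        \<P>(\<omega> in M. X (Suc n) \<omega> = y \<bar> \<forall>i\<le>n. X i \<omega> = s i) = pmf (K (s n)) y)"

definition chain_law :: "'w measure \<Rightarrow> (nat \<Rightarrow> 'w \<Rightarrow> 'a) \<Rightarrow> nat \<Rightarrow> 'a measure" where
  "chain_law M X n = distr M (count_space UNIV) (X n)"

definition halting_state ::
    "'w measure \<Rightarrow> (nat \<Rightarrow> 'w \<Rightarrow> 'a) \<Rightarrow> 'a pmf \<Rightarrow> 'a \<Rightarrow> bool" where
  "halting_state M X \<pi> x \<longleftrightarrow> (\<forall>n. measure (chain_law M X n) {x} \<le> pmf \<pi> x)"

end

theory Submission
  imports Defs
begin

text \<open>The law of the chain at time \<open>n\<close> is the measure \<open>K\<^sup>n(\<bottom>, \<cdot>)\<close>. The indicator of \<open>{\<top>}\<close> is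
  increasing because \<open>\<top>\<close> is the largest element, and monotone kernels compose, so
  \<open>x \<mapsto> K\<^sup>n(x, \<top>)\<close> is increasing for each \<open>n\<close>; in particular \<open>K\<^sup>n(\<bottom>, \<top>) \<le> K\<^sup>n(x, \<top>)\<close> for every \<open>x\<close>.
  Averaging this inequality over \<open>x\<close> distributed according to \<open>\<pi>\<close> turns the right-hand side into
  \<open>\<pi>(\<top>)\<close> by stationarity. The order argument is \<open>mono_expectation_kernel_power\<close> together with
  \<open>stationary_kernel_power\<close>; the other half, \<open>markov_chain_prob_eq_kernel_power\<close>, identifies
  the law of the process by summing the Markov property, which conditions on whole histories,
  over the finitely many histories that lead to a given state.\<close>

lemma kernel_power_0 [simp]: "kernel_power K 0 x = return_pmf x"
  by (simp add: kernel_power_def)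

lemma kernel_power_Suc: "kernel_power K (Suc n) x = bind_pmf (kernel_power K n x) K"
  by (simp add: kernel_power_def)

lemma stationary_kernel_power:
  assumes "stationary K \<pi>"
  shows "bind_pmf \<pi> (kernel_power K n) = \<pi>"
proof (induction n)
  case 0
  have "kernel_power K 0 = return_pmf"
    by (simp add: fun_eq_iff)
  then show ?case
    by (simp add: bind_return_pmf')
next
  case (Suc n)
  have "bind_pmf \<pi> (kernel_power K (Suc n)) = bind_pmf (bind_pmf \<pi> (kernel_power K n)) K"
    by (simp add: bind_assoc_pmf kernel_power_Suc[abs_def])
  then show ?case
    using Suc assms by (simp add: stationary_def)
qed

lemma expectation_bind_pmf_finite:
  fixes K :: "'a::finite \<Rightarrow> 'b::finite pmf" and f :: "'b \<Rightarrow> real"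
  shows "measure_pmf.expectation (bind_pmf p K) f
    = measure_pmf.expectation p (\<lambda>x. measure_pmf.expectation (K x) f)"
proof -
  have "measure_pmf.expectation (bind_pmf p K) f
      = (\<Sum>x\<in>UNIV. pmf p x *\<^sub>R measure_pmf.expectation (K x) f)"
    by (rule pmf_expectation_bind) auto
  also have "\<dots> = measure_pmf.expectation p (\<lambda>x. measure_pmf.expectation (K x) f)"
    by (rule integral_measure_pmf[symmetric]) auto
  finally show ?thesis .
qed

text \<open>Since \<open>K\<^sup>n\<^sup>+\<^sup>1 f = K\<^sup>n (K f)\<close> and \<open>K f\<close> is again increasing, the induction has to let \<open>f\<close> vary.\<close>

lemma mono_expectation_kernel_power:
  fixes K :: "'a::{finite, order} \<Rightarrow> 'a pmf" and f :: "'a \<Rightarrow> real"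
  assumes "monotone_kernel K" and "mono f"
  shows "mono (\<lambda>x. measure_pmf.expectation (kernel_power K n x) f)"
  using assms(2)
proof (induction n arbitrary: f)
  case 0
  then show ?case by simp
next
  case (Suc n)
  have "mono (\<lambda>x. measure_pmf.expectation (K x) f)"
    using assms(1) Suc.prems by (simp add: monotone_kernel_def)
  from Suc.IH[OF this] show ?case
    by (simp add: kernel_power_Suc expectation_bind_pmf_finite)
qed

lemma pmf_eq_expectation_indicator:
  "pmf p y = measure_pmf.expectation p (indicator {y})"
  by (simp add: measure_pmf_single)

lemma kernel_power_bot_top_le_stationary:
  fixes K :: "'a :: {finite, order_bot, order_top} \<Rightarrow> 'a pmf"
  assumes "monotone_kernel K" and "stationary K \<pi>"
  shows "pmf (kernel_power K n bot) top \<le> pmf \<pi> top"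
proof -
  have "mono (indicator {top::'a} :: 'a \<Rightarrow> real)"
    by (auto simp: mono_def indicator_def top_unique)
  then have "mono (\<lambda>x. pmf (kernel_power K n x) top)"
    unfolding pmf_eq_expectation_indicator
    by (rule mono_expectation_kernel_power[OF assms(1)])
  then have le: "pmf (kernel_power K n bot) top \<le> pmf (kernel_power K n x) top" for x
    by (simp add: mono_def)
  have "pmf (kernel_power K n bot) top
      = measure_pmf.expectation \<pi> (\<lambda>x. pmf (kernel_power K n bot) top)"
    by simp
  also have "\<dots> \<le> measure_pmf.expectation \<pi> (\<lambda>x. pmf (kernel_power K n x) top)"
    by (intro integral_mono le integrable_measure_pmf_finite) auto
  also have "\<dots> = pmf (bind_pmf \<pi> (kernel_power K n)) top"
    by (simp add: pmf_bind)
  also have "\<dots> = pmf \<pi> top"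
    by (simp add: stationary_kernel_power[OF assms(2)])
  finally show ?thesis .
qed

text \<open>Clearing the denominator of the conditional probability makes the Markov property hold for all
  histories, including the null ones, so that it can be summed over histories.\<close>

lemma markov_chain_history_step:
  assumes "markov_chain M X (K :: 'a::finite \<Rightarrow> 'a pmf)"
  shows "\<P>(\<omega> in M. X (Suc n) \<omega> = y \<and> (\<forall>i\<le>n. X i \<omega> = s i))
    = \<P>(\<omega> in M. \<forall>i\<le>n. X i \<omega> = s i) * pmf (K (s n)) y"
proof -
  interpret prob_space M
    using assms by (simp add: markov_chain_def)
  have [measurable]: "X i \<in> measurable M (count_space UNIV)" for i
    using assms by (simp add: markov_chain_def)
  show ?thesis
  proof (cases "\<P>(\<omega> in M. \<forall>i\<le>n. X i \<omega> = s i) > 0")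
    case True
    then have "\<P>(\<omega> in M. X (Suc n) \<omega> = y \<bar> \<forall>i\<le>n. X i \<omega> = s i) = pmf (K (s n)) y"
      using assms by (simp add: markov_chain_def)
    with True show ?thesis
      by (simp add: cond_prob_def field_simps)
  next
    case False
    then have null: "\<P>(\<omega> in M. \<forall>i\<le>n. X i \<omega> = s i) = 0"
      by (simp add: zero_less_measure_iff)
    have "\<P>(\<omega> in M. X (Suc n) \<omega> = y \<and> (\<forall>i\<le>n. X i \<omega> = s i))
        \<le> \<P>(\<omega> in M. \<forall>i\<le>n. X i \<omega> = s i)"
      by (intro finite_measure_mono) auto
    with null show ?thesis
      by (simp add: measure_le_0_iff)
  qed
qed

lemma markov_chain_state_step:
  assumes "markov_chain M X (K :: 'a::finite \<Rightarrow> 'a pmf)"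
  shows "\<P>(\<omega> in M. X (Suc n) \<omega> = y \<and> X n \<omega> = x) = \<P>(\<omega> in M. X n \<omega> = x) * pmf (K x) y"
proof -
  interpret prob_space M
    using assms by (simp add: markov_chain_def)
  have [measurable]: "X i \<in> measurable M (count_space UNIV)" for i
    using assms by (simp add: markov_chain_def)
  \<comment> \<open>Extensional functions on \<open>{..n}\<close> represent each history exactly once.\<close>
  define S where "S = {s \<in> {..n} \<rightarrow>\<^sub>E (UNIV :: 'a set). s n = x}"
  have fin: "finite S"
    unfolding S_def by (rule finite_subset[OF _ finite_PiE[of "{..n}" "\<lambda>_. UNIV"]]) auto
  have unique: "\<exists>!s. s \<in> S \<and> (\<forall>i\<le>n. X i \<omega> = s i)" if "X n \<omega> = x" for \<omega>
  proof (rule ex1I[of _ "restrict (\<lambda>i. X i \<omega>) {..n}"])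
    show "restrict (\<lambda>i. X i \<omega>) {..n} \<in> S \<and> (\<forall>i\<le>n. X i \<omega> = restrict (\<lambda>i. X i \<omega>) {..n} i)"
      using that by (simp add: S_def)
  next
    fix s
    assume "s \<in> S \<and> (\<forall>i\<le>n. X i \<omega> = s i)"
    then show "s = restrict (\<lambda>i. X i \<omega>) {..n}"
      by (intro extensionalityI[of _ "{..n}"]) (auto simp: S_def PiE_def)
  qed
  have "\<P>(\<omega> in M. X (Suc n) \<omega> = y \<and> X n \<omega> = x)
      = (\<Sum>s\<in>S. \<P>(\<omega> in M. X (Suc n) \<omega> = y \<and> (\<forall>i\<le>n. X i \<omega> = s i)))"
  proof (rule prob_sum[OF fin])
    show "AE \<omega> in M. (\<forall>s\<in>S. X (Suc n) \<omega> = y \<and> (\<forall>i\<le>n. X i \<omega> = s i)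
          \<longrightarrow> X (Suc n) \<omega> = y \<and> X n \<omega> = x)
        \<and> (X (Suc n) \<omega> = y \<and> X n \<omega> = x
          \<longrightarrow> (\<exists>!s. s \<in> S \<and> X (Suc n) \<omega> = y \<and> (\<forall>i\<le>n. X i \<omega> = s i)))"
      using unique by (intro AE_I2) (auto simp: S_def)
  qed measurable
  also have "\<dots> = (\<Sum>s\<in>S. \<P>(\<omega> in M. \<forall>i\<le>n. X i \<omega> = s i) * pmf (K x) y)"
    by (intro sum.cong refl) (simp add: markov_chain_history_step[OF assms] S_def)
  also have "\<dots> = (\<Sum>s\<in>S. \<P>(\<omega> in M. \<forall>i\<le>n. X i \<omega> = s i)) * pmf (K x) y"
    by (simp add: sum_distrib_right)
  also have "(\<Sum>s\<in>S. \<P>(\<omega> in M. \<forall>i\<le>n. X i \<omega> = s i)) = \<P>(\<omega> in M. X n \<omega> = x)"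
  proof (rule prob_sum[OF fin, symmetric])
    show "AE \<omega> in M. (\<forall>s\<in>S. (\<forall>i\<le>n. X i \<omega> = s i) \<longrightarrow> X n \<omega> = x)
        \<and> (X n \<omega> = x \<longrightarrow> (\<exists>!s. s \<in> S \<and> (\<forall>i\<le>n. X i \<omega> = s i)))"
      using unique by (intro AE_I2) (auto simp: S_def)
  qed measurable
  finally show ?thesis .
qed

lemma markov_chain_prob_eq_kernel_power:
  assumes chain: "markov_chain M X (K :: 'a::finite \<Rightarrow> 'a pmf)"
    and start: "AE \<omega> in M. X 0 \<omega> = x\<^sub>0"
  shows "\<P>(\<omega> in M. X n \<omega> = y) = pmf (kernel_power K n x\<^sub>0) y"
proof -
  interpret prob_space M
    using chain by (simp add: markov_chain_def)
  have [measurable]: "X i \<in> measurable M (count_space UNIV)" for i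
    using chain by (simp add: markov_chain_def)
  show ?thesis
  proof (induction n arbitrary: y)
    case 0
    have "\<P>(\<omega> in M. X 0 \<omega> = y) = \<P>(\<omega> in M. x\<^sub>0 = y)"
      using start by (intro prob_eq_AE) auto
    then show ?case
      by (cases "x\<^sub>0 = y") (auto simp: prob_space)
  next
    case (Suc n)
    have "\<P>(\<omega> in M. X (Suc n) \<omega> = y)
        = (\<Sum>x\<in>UNIV. \<P>(\<omega> in M. X (Suc n) \<omega> = y \<and> X n \<omega> = x))"
      by (rule prob_sum) auto
    also have "\<dots> = (\<Sum>x\<in>UNIV. pmf (kernel_power K n x\<^sub>0) x * pmf (K x) y)"
      by (simp add: markov_chain_state_step[OF chain] Suc.IH)
    also have "\<dots> = pmf (kernel_power K (Suc n) x\<^sub>0) y"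
      by (simp add: kernel_power_Suc pmf_bind integral_measure_pmf_real[of UNIV] mult.commute)
    finally show ?case .
  qed
qed

theorem proposition3p2:
  fixes K :: "'a :: {finite, order_bot, order_top} \<Rightarrow> 'a pmf"
    and \<pi> :: "'a pmf"
    and M :: "'w measure"
    and X :: "nat \<Rightarrow> 'w \<Rightarrow> 'a"
  assumes "irreducible_kernel K"
    and "monotone_kernel K"
    and "stationary K \<pi>"
    and "markov_chain M X K"
    and "AE \<omega> in M. X 0 \<omega> = bot"
  shows "halting_state M X \<pi> top"
  unfolding halting_state_def
proof
  fix n
  have "X n \<in> measurable M (count_space UNIV)"
    using assms(4) by (simp add: markov_chain_def)
  then have "measure (chain_law M X n) {top} = \<P>(\<omega> in M. X n \<omega> = top)"
    by (simp add: chain_law_def measure_distr vimage_def Int_def conj_commute)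
  also have "\<dots> = pmf (kernel_power K n bot) top"
    by (rule markov_chain_prob_eq_kernel_power[OF assms(4,5)])
  also have "\<dots> \<le> pmf \<pi> top"
    by (rule kernel_power_bot_top_le_stationary[OF assms(2,3)])
  finally show "measure (chain_law M X n) {top} \<le> pmf \<pi> top" .
qed

end
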